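(* For every integer $m\ge1$ and every $\epsilon>0$ there is a prophet inequality instance, consisting of an $m$-frequent multiset of independent nonnegative distributions together with an order in which they are revealed, such that no online algorithm is a $(0.5+\epsilon)$-approximation on it: every online algorithm has expected accepted value strictly less than $(0.5+\epsilon)\,\mathbb{E}[\max_i X_i]$.
   Context: Prophet inequality: independent nonnegative random variables $X_1,\dots,X_n$ with known distributions are revealed one by one in a fixed (here adversarially chosen) order; on seeing a value an online algorithm must irrevocably accept it (and stop) or reject it; its value is the accepted value ($0$ if none). A $\beta$-approximation achieves expected value at least $\beta\,\mathbb{E}[\max_iX_i]$. A multiset of distributions is $m$-frequent if each distribution in it appears at least $m$ times. *)

theory Defs
  imports "HOL-Probability.Probability" "HOL-Library.Multiset"
begin

definition nonneg_distribution :: "real measure \<Rightarrow> bool" where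
  "nonneg_distribution D \<longleftrightarrow>
     prob_space D \<and> sets D = sets borel \<and> (AE x in D. 0 \<le> x) \<and> integrable D (\<lambda>x. x)"

text \<open>An instance is the list of distributions in the order in which they are revealed;
  the underlying multiset of distributions is its \<open>mset\<close>.\<close>

definition prophet_instance :: "real measure list \<Rightarrow> bool" where
  "prophet_instance Ds \<longleftrightarrow> Ds \<noteq> [] \<and> (\<forall>D \<in> set Ds. nonneg_distribution D)"

definition frequent :: "nat \<Rightarrow> 'a multiset \<Rightarrow> bool" where
  "frequent m A \<longleftrightarrow> (\<forall>D \<in># A. m \<le> count A D)"

definition joint_distribution :: "real measure list \<Rightarrow> (nat \<Rightarrow> real) measure" where
  "joint_distribution Ds = (\<Pi>\<^sub>M i\<in>{..<length Ds}. Ds ! i)"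

definition expected_max :: "real measure list \<Rightarrow> real" where
  "expected_max Ds = (\<integral>x. Max (x ` {..<length Ds}) \<partial>joint_distribution Ds)"

text \<open>A (possibly randomized) online algorithm consists of a probability space \<open>R\<close>, from which
  a seed \<open>r\<close> is drawn independently of the values, and of decisions: \<open>accept i r h\<close> says whether
  the algorithm with seed \<open>r\<close>, not having stopped before, accepts the value at position \<open>i\<close>
  after having seen the history \<open>h\<close>, i.e. the values at the positions \<open>0, \<dots>, i\<close>.
  Deterministic algorithms are those that ignore \<open>r\<close>.\<close>

definition online_algorithm ::
    "nat \<Rightarrow> 'r measure \<Rightarrow> (nat \<Rightarrow> 'r \<Rightarrow> (nat \<Rightarrow> real) \<Rightarrow> bool) \<Rightarrow> bool" where
  "online_algorithm n R accept \<longleftrightarrow> prob_space R \<and>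
     (\<forall>i<n. (\<lambda>(r, h). accept i r h)
        \<in> measurable (R \<Otimes>\<^sub>M (\<Pi>\<^sub>M j\<in>{..i}. borel)) (count_space UNIV))"

definition accepts_at ::
    "(nat \<Rightarrow> 'r \<Rightarrow> (nat \<Rightarrow> real) \<Rightarrow> bool) \<Rightarrow> 'r \<Rightarrow> (nat \<Rightarrow> real) \<Rightarrow> nat \<Rightarrow> bool" where
  "accepts_at accept r x i \<longleftrightarrow> accept i r (restrict x {..i})"

definition accepted_value ::
    "nat \<Rightarrow> (nat \<Rightarrow> 'r \<Rightarrow> (nat \<Rightarrow> real) \<Rightarrow> bool) \<Rightarrow> 'r \<Rightarrow> (nat \<Rightarrow> real) \<Rightarrow> real" where
  "accepted_value n accept r x =
     (if \<exists>i<n. accepts_at accept r x i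
      then x (LEAST i. accepts_at accept r x i) else 0)"

definition expected_accepted_value ::
    "real measure list \<Rightarrow> 'r measure \<Rightarrow> (nat \<Rightarrow> 'r \<Rightarrow> (nat \<Rightarrow> real) \<Rightarrow> bool) \<Rightarrow> real" where
  "expected_accepted_value Ds R accept =
     (\<integral>(r, x). accepted_value (length Ds) accept r x \<partial>(R \<Otimes>\<^sub>M joint_distribution Ds))"

end

theory Submission
  imports Defs
begin

text \<open>Reveal \<open>m\<close> copies of the constant 1, followed by \<open>m\<close> copies of a variable that equals
  \<open>1 / t\<close> with the small probability \<open>t / m\<close> and 0 otherwise. Whether an algorithm stops among the
  constants depends on its seed alone; if it does, it gets 1, and if it does not, it gets at most
  the sum of the remaining values, whose expectation is also 1. The prophet takes a value
  \<open>1 / t\<close> if there is one, which happens with probability close to \<open>t\<close>, and otherwise takes 1, so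
  that the expected maximum tends to 2 as \<open>t\<close> tends to 0.\<close>

section \<open>Point masses and two-point distributions\<close>

lemma integrable_return_borel:
  fixes f :: "real \<Rightarrow> real"
  assumes [measurable]: "f \<in> borel_measurable borel"
  shows "integrable (return borel a) f"
proof -
  interpret prob_space "return borel a" by (rule prob_space_return) simp
  show ?thesis
    by (rule integrable_const_bound[where B = "norm (f a)"]) (auto simp: AE_return)
qed

text \<open>Pushing a Bernoulli \<open>pmf\<close> forward into \<open>borel\<close> yields the
  sigma-algebra that \<open>nonneg_distribution\<close> asks for, while integrals remain sums of two
  terms. As \<open>bernoulli_pmf\<close> clamps its parameter, this is a probability space for every
  real \<open>p\<close>.\<close>

definition two_point :: "real \<Rightarrow> real \<Rightarrow> real measure" where
  "two_point V p = distr (measure_pmf (bernoulli_pmf p)) borel (\<lambda>b. if b then V else 0)"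

lemma sets_two_point [measurable_cong, simp]: "sets (two_point V p) = sets borel"
  by (simp add: two_point_def)

lemma prob_space_two_point: "prob_space (two_point V p)"
  unfolding two_point_def by (intro prob_space.prob_space_distr prob_space_measure_pmf) simp

lemma AE_two_point: "AE x in two_point V p. x = 0 \<or> x = V"
  unfolding two_point_def by (subst AE_distr_iff) auto

lemma integrable_two_point:
  fixes f :: "real \<Rightarrow> real"
  assumes [measurable]: "f \<in> borel_measurable borel"
  shows "integrable (two_point V p) f"
  unfolding two_point_def
  by (subst integrable_distr_eq) (auto intro: integrable_measure_pmf_finite)

lemma integral_two_point:
  fixes f :: "real \<Rightarrow> real"
  assumes [measurable]: "f \<in> borel_measurable borel" and "0 \<le> p" "p \<le> 1"
  shows "integral\<^sup>L (two_point V p) f = p * f V + (1 - p) * f 0"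
  unfolding two_point_def using assms by (subst integral_distr) auto

section \<open>The hard instance and its product distribution\<close>

definition hard_instance :: "nat \<Rightarrow> real \<Rightarrow> real \<Rightarrow> real measure list" where
  "hard_instance m V p = replicate m (return borel 1) @ replicate m (two_point V p)"

text \<open>Unlike \<open>hard_instance m V p ! i\<close>, this is a probability space at every
  index, including those beyond the list, as \<open>product_sigma_finite\<close> requires.\<close>

definition hard_marginal :: "nat \<Rightarrow> real \<Rightarrow> real \<Rightarrow> nat \<Rightarrow> real measure" where
  "hard_marginal m V p i = (if i < m then return borel 1 else two_point V p)"

lemma sets_hard_marginal [measurable_cong, simp]: "sets (hard_marginal m V p i) = sets borel"
  by (simp add: hard_marginal_def)

lemma prob_space_hard_marginal: "prob_space (hard_marginal m V p i)"
  by (auto simp: hard_marginal_def prob_space_two_point intro: prob_space_return)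

lemma length_hard_instance [simp]: "length (hard_instance m V p) = 2 * m"
  by (simp add: hard_instance_def)

lemma joint_distribution_hard_instance:
  "joint_distribution (hard_instance m V p) = (\<Pi>\<^sub>M i\<in>{..<2 * m}. hard_marginal m V p i)"
  unfolding joint_distribution_def
  by (intro PiM_cong) (auto simp: hard_instance_def hard_marginal_def nth_append)

lemma frequent_hard_instance: "frequent m (mset (hard_instance m V p))"
  by (auto simp: frequent_def hard_instance_def)

lemma prophet_instance_hard_instance:
  assumes "m \<ge> 1" "V \<ge> 0"
  shows "prophet_instance (hard_instance m V p)"
proof -
  have "nonneg_distribution (return borel (1::real))"
    unfolding nonneg_distribution_def
    by (auto simp: AE_return intro: prob_space_return integrable_return_borel)
  moreover have "nonneg_distribution (two_point V p)"
    unfolding nonneg_distribution_def using AE_two_point[of V p] assms(2)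
    by (auto simp: prob_space_two_point intro: integrable_two_point elim: eventually_mono)
  ultimately show ?thesis
    using assms(1) by (auto simp: prophet_instance_def hard_instance_def)
qed

text \<open>Each coordinate almost surely lies in the support of its marginal, and finitely many
  null sets can be discarded together. The bounds for the prophet and for the algorithms argue
  pointwise on this event.\<close>

lemma AE_hard_marginal:
  "AE x in (\<Pi>\<^sub>M i\<in>{..<2 * m}. hard_marginal m V p i).
     (\<forall>i\<in>{..<m}. x i = 1) \<and> (\<forall>i\<in>{m..<2 * m}. x i = 0 \<or> x i = V)"
proof (intro AE_conjI AE_finite_allI)
  fix i assume "i \<in> {..<m}"
  moreover from this have "hard_marginal m V p i = return borel 1"
    by (simp add: hard_marginal_def)
  then have "AE y in hard_marginal m V p i. y = 1"
    by (simp only:) (simp add: AE_return)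
  ultimately show "AE x in (\<Pi>\<^sub>M i\<in>{..<2 * m}. hard_marginal m V p i). x i = 1"
    by (intro AE_PiM_component[where P = "\<lambda>y. y = 1"] prob_space_hard_marginal) auto
next
  fix i assume "i \<in> {m..<2 * m}"
  moreover from this have "hard_marginal m V p i = two_point V p"
    by (simp add: hard_marginal_def)
  then have "AE y in hard_marginal m V p i. y = 0 \<or> y = V"
    by (simp only: AE_two_point)
  ultimately show "AE x in (\<Pi>\<^sub>M i\<in>{..<2 * m}. hard_marginal m V p i). x i = 0 \<or> x i = V"
    by (intro AE_PiM_component[where P = "\<lambda>y. y = 0 \<or> y = V"] prob_space_hard_marginal) auto
qed auto

section \<open>Lower bound for the prophet\<close>

text \<open>The maximum is at least \<open>V\<close> if some late value equals \<open>V\<close>, and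
  at least 1 otherwise. By independence the second case has probability
  \<open>(1 - p) ^ m\<close>.\<close>

lemma expected_max_hard_instance_ge:
  assumes "m \<ge> 1" "V \<ge> 1" "0 \<le> p" "p \<le> 1"
  shows "V - (V - 1) * (1 - p) ^ m \<le> expected_max (hard_instance m V p)"
proof -
  let ?M = "hard_marginal m V p"
  let ?J = "\<Pi>\<^sub>M i\<in>{..<2 * m}. ?M i"
  \<comment> \<open>The product of all \<open>f i (x i)\<close> is the indicator that no late value
    equals \<open>V\<close>. In this form \<open>product_integral_prod\<close> evaluates its
    expectation. Early factors are 1 regardless of the value, so the constants do not count even if
    \<open>V = 1\<close>.\<close>
  define f :: "nat \<Rightarrow> real \<Rightarrow> real"
    where "f i y = (if i < m then 1 else if y = V then 0 else 1)" for i y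
  have f_meas [measurable]: "f i \<in> borel_measurable borel" for i
    unfolding f_def by measurable
  interpret product_sigma_finite ?M
    by (intro product_sigma_finite.intro prob_space_imp_sigma_finite prob_space_hard_marginal)
  interpret J: prob_space ?J
    by (intro prob_space_PiM prob_space_hard_marginal)
  have f_int: "integrable (?M i) (f i)" for i
    by (auto simp: hard_marginal_def intro: integrable_two_point integrable_return_borel)
  have f_val: "integral\<^sup>L (?M i) (f i) = (if i < m then 1 else 1 - p)" for i
    using assms by (auto simp: hard_marginal_def integral_return integral_two_point f_def)
  have "(\<Prod>i<2 * m. if i < m then 1 else 1 - p) = (\<Prod>i=m..<2 * m. 1 - p)"
    by (rule prod.mono_neutral_cong_right) auto
  then have prod_val: "(\<integral>x. (\<Prod>i<2 * m. f i (x i)) \<partial>?J) = (1 - p) ^ m"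
    using product_integral_prod[of "{..<2 * m}" f] f_int f_val by simp
  have prod_int: "integrable ?J (\<lambda>x. \<Prod>i<2 * m. f i (x i))"
    by (intro product_integrable_prod f_int) auto
  have Max_meas [measurable]: "(\<lambda>x. Max (x ` {..<2 * m})) \<in> borel_measurable ?J"
    using borel_measurable_Max[of "{..<2 * m}" "\<lambda>i x. x i" ?J] by simp
  have "V - (V - 1) * (1 - p) ^ m = (\<integral>x. V - (V - 1) * (\<Prod>i<2 * m. f i (x i)) \<partial>?J)"
    using prod_int prod_val J.prob_space by simp
  also have "\<dots> \<le> (\<integral>x. Max (x ` {..<2 * m}) \<partial>?J)"
  proof (rule integral_mono_AE)
    show "integrable ?J (\<lambda>x. V - (V - 1) * (\<Prod>i<2 * m. f i (x i)))"
      using prod_int by simp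
    \<comment> \<open>The maximum is almost surely bounded: all values lie in \<open>{0..V}\<close>,
      the ones because \<open>V \<ge> 1\<close>.\<close>
    show "integrable ?J (\<lambda>x. Max (x ` {..<2 * m}))"
    proof (rule J.integrable_const_bound[where B = V])
      show "AE x in ?J. norm (Max (x ` {..<2 * m})) \<le> V"
        using AE_hard_marginal
      proof eventually_elim
        case (elim x)
        have "x i = 1 \<or> x i = 0 \<or> x i = V" if "i < 2 * m" for i
          using elim that by (meson atLeastLessThan_iff lessThan_iff not_le)
        then have "x ` {..<2 * m} \<subseteq> {0..V}"
          using assms(2) by (intro image_subsetI) fastforce
        moreover have "Max (x ` {..<2 * m}) \<in> x ` {..<2 * m}"
          using assms(1) by (intro Max_in) (auto simp: lessThan_empty_iff)
        ultimately have "Max (x ` {..<2 * m}) \<in> {0..V}" by blast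
        then show ?case by simp
      qed
    qed measurable
    show "AE x in ?J. V - (V - 1) * (\<Prod>i<2 * m. f i (x i)) \<le> Max (x ` {..<2 * m})"
      using AE_hard_marginal
    proof eventually_elim
      case (elim x)
      have Max_ge: "x i \<le> Max (x ` {..<2 * m})" if "i < 2 * m" for i
        using that by (intro Max_ge) auto
      show ?case
      proof (cases "\<exists>i\<in>{m..<2 * m}. x i = V")
        case True
        then obtain i where i: "i \<in> {m..<2 * m}" "x i = V" by blast
        then have prod_0: "(\<Prod>i<2 * m. f i (x i)) = 0"
          by (intro prod_zero) (auto simp: f_def intro!: bexI[of _ i])
        show ?thesis unfolding prod_0 using Max_ge[of i] i by simp
      next
        case False
        then have prod_1: "(\<Prod>i<2 * m. f i (x i)) = 1"
          by (intro prod.neutral) (auto simp: f_def)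
        \<comment> \<open>With the product equal to 1 the left side is
          \<open>V - (V - 1) = 1\<close>, which the first constant attains; it exists because
          \<open>m \<ge> 1\<close>.\<close>
        have "x 0 = 1" using elim assms(1) by auto
        then show ?thesis unfolding prod_1 using Max_ge[of 0] assms(1) by simp
      qed
    qed
  qed
  finally show ?thesis
    by (simp add: expected_max_def joint_distribution_hard_instance)
qed

section \<open>Upper bound for online algorithms\<close>

text \<open>As long as only ones have appeared, the history carries no information, so the case
  distinction on the right depends on \<open>r\<close> alone. Stopping early gives 1; a value
  accepted later is one summand of a sum of nonnegative terms.\<close>

lemma accepted_value_le:
  assumes ones: "\<And>i. i < m \<Longrightarrow> x i = 1"
    and nonneg: "\<And>i. i \<in> {m..<n} \<Longrightarrow> 0 \<le> x i"
  shows "accepted_value n accept r x \<le>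
    (if \<exists>i<m. accept i r (restrict (\<lambda>_. 1) {..i}) then 1 else \<Sum>i=m..<n. x i)"
proof -
  \<comment> \<open>This covers the algorithm that never stops and receives the default 0.\<close>
  have sum_nonneg: "0 \<le> (\<Sum>i=m..<n. x i)"
    by (intro sum_nonneg nonneg)
  have early: "accepts_at accept r x i \<longleftrightarrow> accept i r (restrict (\<lambda>_. 1) {..i})" if "i < m" for i
  proof -
    have "restrict x {..i} = restrict (\<lambda>_. 1) {..i}"
      using that ones by (intro restrict_ext) auto
    then show ?thesis by (simp add: accepts_at_def)
  qed
  let ?L = "LEAST i. accepts_at accept r x i"
  show ?thesis
  proof (cases "\<exists>i<n. accepts_at accept r x i")
    case False
    then show ?thesis using sum_nonneg by (auto simp: accepted_value_def)
  next
    case True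
    then obtain i where i: "i < n" "accepts_at accept r x i" by blast
    then have L: "accepts_at accept r x ?L" "?L < n"
      using LeastI[of "accepts_at accept r x" i] Least_le[of "accepts_at accept r x" i] by auto
    have val: "accepted_value n accept r x = x ?L"
      using True by (simp add: accepted_value_def)
    show ?thesis
    proof (cases "\<exists>i<m. accept i r (restrict (\<lambda>_. 1) {..i})")
      case True
      then obtain j where "j < m" "accepts_at accept r x j" using early by blast
      then have "?L < m" using Least_le[of "accepts_at accept r x" j] by simp
      then show ?thesis using val ones True by simp
    next
      case False
      then have "?L \<in> {m..<n}" using L early[of ?L] by force
      then have "x ?L \<le> (\<Sum>i=m..<n. x i)"
        by (intro member_le_sum) (auto intro: nonneg)
      then show ?thesis unfolding if_not_P[OF False] val .
    qed
  qed
qed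

text \<open>By linearity, since each late coordinate has mean \<open>p * V\<close>. The nonnegative
  integral is the form in which the sum appears once Tonelli has split off the seed.\<close>

lemma nn_integral_hard_tail:
  assumes "V \<ge> 0" "0 \<le> p" "p \<le> 1"
  shows "(\<integral>\<^sup>+x. ennreal (\<Sum>i=m..<2 * m. x i) \<partial>(\<Pi>\<^sub>M i\<in>{..<2 * m}. hard_marginal m V p i))
    = ennreal (real m * (p * V))"
proof -
  let ?M = "hard_marginal m V p"
  let ?J = "\<Pi>\<^sub>M i\<in>{..<2 * m}. ?M i"
  have distr: "distr ?J (two_point V p) (\<lambda>x. x i) = two_point V p" if "i \<in> {m..<2 * m}" for i
  proof -
    have "?M i = two_point V p" using that by (simp add: hard_marginal_def)
    then show ?thesis
      using distr_PiM_component[of "{..<2 * m}" ?M i] that prob_space_hard_marginal by simp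
  qed
  have proj: "(\<lambda>x. x i) \<in> ?J \<rightarrow>\<^sub>M two_point V p" if "i \<in> {m..<2 * m}" for i
  proof -
    have "?M i = two_point V p" using that by (simp add: hard_marginal_def)
    then show ?thesis
      using measurable_component_singleton[of i "{..<2 * m}" ?M] that by simp
  qed
  have int: "integrable ?J (\<lambda>x. x i)" if "i \<in> {m..<2 * m}" for i
    by (rule integrable_distr[OF proj[OF that], of "\<lambda>y. y", unfolded distr[OF that]])
       (rule integrable_two_point, rule measurable_ident_sets[OF refl])
  have val: "(\<integral>x. x i \<partial>?J) = p * V" if "i \<in> {m..<2 * m}" for i
  proof -
    have "(\<lambda>y. y) \<in> borel_measurable (two_point V p)" by simp
    from integral_distr[OF proj[OF that] this, unfolded distr[OF that]]
    show ?thesis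
      using integral_two_point[of "\<lambda>y. y" p V, OF measurable_ident_sets[OF refl]] assms by simp
  qed
  have "(\<integral>\<^sup>+x. ennreal (\<Sum>i=m..<2 * m. x i) \<partial>?J) = ennreal (\<integral>x. (\<Sum>i=m..<2 * m. x i) \<partial>?J)"
  proof (rule nn_integral_eq_integral)
    show "AE x in ?J. 0 \<le> (\<Sum>i=m..<2 * m. x i)"
      using AE_hard_marginal
    proof eventually_elim
      case (elim x)
      then have "0 \<le> x i" if "i \<in> {m..<2 * m}" for i
        using that assms(1) by fastforce
      then show ?case by (rule sum_nonneg)
    qed
  qed (intro Bochner_Integration.integrable_sum int)
  also have "(\<integral>x. (\<Sum>i=m..<2 * m. x i) \<partial>?J) = real m * (p * V)"
    using int val by (subst Bochner_Integration.integral_sum) auto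
  finally show ?thesis .
qed

text \<open>For each fixed seed the bound from \<open>accepted_value_le\<close> has expectation at
  most 1: it is either the constant 1 or a sum of mean \<open>m * (p * V)\<close>. Averaging over
  seeds preserves this.\<close>

lemma expected_accepted_value_hard_instance_le:
  assumes alg: "online_algorithm (2 * m) R accept"
    and p: "0 \<le> p" "p \<le> 1" and V: "V \<ge> 0" and mpV: "real m * (p * V) \<le> 1"
  shows "expected_accepted_value (hard_instance m V p) R accept \<le> 1"
proof -
  let ?J = "\<Pi>\<^sub>M i\<in>{..<2 * m}. hard_marginal m V p i"
  define A where "A r \<longleftrightarrow> (\<exists>i<m. accept i r (restrict (\<lambda>_. 1) {..i}))" for r
  define g where "g r x = (if A r then 1 else \<Sum>i=m..<2 * m. x i)" for r and x :: "nat \<Rightarrow> real"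
  interpret R: prob_space R using alg by (simp add: online_algorithm_def)
  interpret J: prob_space ?J by (intro prob_space_PiM prob_space_hard_marginal)
  interpret RJ: pair_sigma_finite R ?J ..
  have proj: "(\<lambda>x. x i) \<in> borel_measurable ?J" if "i < 2 * m" for i
    using measurable_component_singleton[of i "{..<2 * m}" "hard_marginal m V p"] that by simp
  have "Measurable.pred R (\<lambda>r. accept i r (restrict (\<lambda>_. 1) {..i}))" if "i < m" for i
  proof -
    \<comment> \<open>Freezing the history at ones turns the joint measurability of the decision
      into measurability in the seed.\<close>
    have seed: "(\<lambda>r. (r, restrict (\<lambda>_. 1) {..i})) \<in> R \<rightarrow>\<^sub>M R \<Otimes>\<^sub>M (\<Pi>\<^sub>M j\<in>{..i}. (borel :: real measure))"
      by (intro measurable_Pair measurable_ident_sets refl measurable_const)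
         (auto simp: space_PiM)
    have "(\<lambda>(r, h). accept i r h) \<in> R \<Otimes>\<^sub>M (\<Pi>\<^sub>M j\<in>{..i}. borel) \<rightarrow>\<^sub>M count_space UNIV"
      using alg that by (simp add: online_algorithm_def)
    from measurable_compose[OF seed this] show ?thesis by simp
  qed
  then have "Measurable.pred R (\<lambda>r. \<exists>i\<in>{..<m}. accept i r (restrict (\<lambda>_. 1) {..i}))"
    by (intro pred_intros_finite) auto
  then have A_meas [measurable]: "Measurable.pred R A"
    by (simp only: A_def[abs_def] Bex_def lessThan_iff)
  have sum_meas [measurable]: "(\<lambda>x. \<Sum>i=m..<2 * m. x i) \<in> borel_measurable ?J"
    by (intro borel_measurable_sum proj) auto
  have g_meas: "(\<lambda>(r, x). g r x) \<in> borel_measurable (R \<Otimes>\<^sub>M ?J)"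
    unfolding g_def by measurable
  have eq_meas: "Measurable.pred ?J (\<lambda>x. x i = c)" if "i < 2 * m" for i and c :: real
  proof -
    note proj[OF that, measurable]
    show ?thesis by measurable
  qed
  \<comment> \<open>Carrying an almost sure property of the values over to the product with
    \<open>R\<close> requires its measurability, hence a named predicate.\<close>
  define Q where "Q x \<longleftrightarrow> (\<forall>i\<in>{..<m}. x i = 1) \<and> (\<forall>i\<in>{m..<2 * m}. x i = 0 \<or> x i = V)"
    for x :: "nat \<Rightarrow> real"
  have Q_meas [measurable]: "Measurable.pred ?J Q"
    unfolding Q_def by (intro pred_intros_logic pred_intros_finite eq_meas) auto
  have "AE z in R \<Otimes>\<^sub>M ?J. Q (snd z)"
  proof (rule RJ.AE_pair_measure)
    show "{z \<in> space (R \<Otimes>\<^sub>M ?J). Q (snd z)} \<in> sets (R \<Otimes>\<^sub>M ?J)"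
      by measurable
    show "AE r in R. AE x in ?J. Q (snd (r, x))"
      unfolding snd_conv Q_def by (intro AE_I2 AE_hard_marginal)
  qed
  then have le: "AE z in R \<Otimes>\<^sub>M ?J. ennreal (case z of (r, x) \<Rightarrow> accepted_value (2 * m) accept r x)
      \<le> ennreal (case z of (r, x) \<Rightarrow> g r x)"
  proof eventually_elim
    case (elim z)
    have "accepted_value (2 * m) accept (fst z) (snd z) \<le> g (fst z) (snd z)"
      unfolding g_def A_def
    proof (rule accepted_value_le)
      show "snd z i = 1" if "i < m" for i
        using elim that unfolding Q_def by simp
      show "0 \<le> snd z i" if "i \<in> {m..<2 * m}" for i
        using elim that V unfolding Q_def by fastforce
    qed
    then show ?case by (auto simp: split_beta intro: ennreal_leI)
  qed
  \<comment> \<open>From here on measurability is asked of the bound \<open>g\<close> alone, which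
    is the function Tonelli is applied to.\<close>
  have "(\<integral>\<^sup>+z. ennreal (case z of (r, x) \<Rightarrow> accepted_value (2 * m) accept r x) \<partial>(R \<Otimes>\<^sub>M ?J))
      \<le> (\<integral>\<^sup>+z. ennreal (case z of (r, x) \<Rightarrow> g r x) \<partial>(R \<Otimes>\<^sub>M ?J))"
    by (rule nn_integral_mono_AE[OF le])
  also have "\<dots> = (\<integral>\<^sup>+r. \<integral>\<^sup>+x. ennreal (g r x) \<partial>?J \<partial>R)"
    by (subst J.nn_integral_fst[symmetric]) (use g_meas in auto)
  also have "\<dots> \<le> (\<integral>\<^sup>+r. 1 \<partial>R)"
  proof (rule nn_integral_mono)
    fix r
    show "(\<integral>\<^sup>+x. ennreal (g r x) \<partial>?J) \<le> 1"
      using nn_integral_hard_tail[OF V p, of m] mpV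
      by (cases "A r") (simp_all add: g_def J.emeasure_space_1)
  qed
  also have "\<dots> = 1" by (simp add: R.emeasure_space_1)
  finally have nn: "(\<integral>\<^sup>+z. ennreal (case z of (r, x) \<Rightarrow> accepted_value (2 * m) accept r x) \<partial>(R \<Otimes>\<^sub>M ?J)) \<le> 1" .
  show ?thesis
    unfolding expected_accepted_value_def joint_distribution_hard_instance length_hard_instance
    \<comment> \<open>This rule also covers a non-integrable integrand, whose Bochner integral is 0;
      negative parts only lower the integral.\<close>
    by (rule integral_real_bounded) (use nn in simp_all)
qed

section \<open>Choice of parameters and conclusion\<close>

theorem theorem4:
  fixes m :: nat and \<epsilon> :: real
  assumes "m \<ge> 1" and "\<epsilon> > 0"
  shows "\<exists>Ds :: real measure list.
           prophet_instance Ds \<and> frequent m (mset Ds) \<and>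
           (\<forall>(R :: real measure) accept. online_algorithm (length Ds) R accept \<longrightarrow>
              expected_accepted_value Ds R accept < (1/2 + \<epsilon>) * expected_max Ds)"
proof -
  \<comment> \<open>Solves \<open>(1/2 + \<epsilon>) * (2 - 2 * t) = 1 + \<epsilon>\<close>, which
    strictly exceeds the bound 1 for algorithms.\<close>
  define t where "t = \<epsilon> / (1 + 2 * \<epsilon>)"
  \<comment> \<open>With \<open>V = 1 / t\<close> this makes the expected sum of the late values,
    \<open>m * (p * V)\<close>, exactly 1. Below, \<open>q\<close> is the probability that all late
    values are 0.\<close>
  define p where "p = t / m"
  define q where "q = (1 - p) ^ m"
  have t: "0 < t" "t < 1" "t * (1 + 2 * \<epsilon>) = \<epsilon>"
    using assms(2) by (auto simp: t_def field_simps)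
  have mp: "real m * p = t" using assms(1) by (simp add: p_def)
  have "p \<le> t" using assms(1) t(1) by (simp add: p_def divide_le_eq)
  then have p: "0 \<le> p" "p \<le> 1" using t by (simp_all add: p_def)
  have q_ge: "1 - t \<le> q"
    using Bernoulli_inequality[of "- p" m] p mp by (simp add: q_def)
  \<comment> \<open>An upper bound on \<open>q\<close> comes from applying Bernoulli to
    \<open>(1 + p) ^ m\<close> instead: the product with \<open>(1 - p) ^ m\<close> is at most
    1.\<close>
  have "(1 + t) * q \<le> (1 + p) ^ m * (1 - p) ^ m"
    using Bernoulli_inequality[of p m] p mp unfolding q_def by (intro mult_right_mono) auto
  also have "\<dots> = (1 - p\<^sup>2) ^ m"
    by (simp add: power_mult_distrib[symmetric] power2_eq_square algebra_simps)
  also have "\<dots> \<le> 1"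
    using p by (intro power_le_one) (auto simp: power_le_one)
  finally have "t * (1 - t) \<le> 1 - q"
  proof -
    assume "(1 + t) * q \<le> 1"
    \<comment> \<open>The factor \<open>1 - t\<close> avoids a division:
      \<open>q - t\<^sup>2 * q\<close> is at most \<open>1 - t\<close>, and \<open>q \<le> 1\<close>
      bounds the quadratic term.\<close>
    then have "(1 - t) * ((1 + t) * q) \<le> (1 - t) * 1"
      using t by (intro mult_left_mono) auto
    moreover have "t\<^sup>2 * q \<le> t\<^sup>2 * 1"
      unfolding q_def using p by (intro mult_left_mono power_le_one) auto
    ultimately show ?thesis
      by (simp add: algebra_simps power2_eq_square)
  qed
  then have "1 - t \<le> (1 - q) / t" using t by (simp add: pos_le_divide_eq mult.commute)
  \<comment> \<open>The right side equals \<open>(1 - q) / t + q\<close>, and both summands are at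
    least \<open>1 - t\<close>.\<close>
  then have "2 - 2 * t \<le> 1 / t - (1 / t - 1) * q"
    using q_ge by (simp add: algebra_simps diff_divide_distrib)
  also have "\<dots> \<le> expected_max (hard_instance m (1 / t) p)"
    unfolding q_def using assms t p by (intro expected_max_hard_instance_ge) auto
  finally have "(1/2 + \<epsilon>) * (2 - 2 * t) \<le> (1/2 + \<epsilon>) * expected_max (hard_instance m (1 / t) p)"
    using assms(2) by (intro mult_left_mono) auto
  moreover have "(1/2 + \<epsilon>) * (2 - 2 * t) = 1 + \<epsilon>"
    using t(3) by (simp add: algebra_simps)
  moreover have "expected_accepted_value (hard_instance m (1 / t) p) R accept \<le> 1"
    if "online_algorithm (2 * m) R accept" for R :: "real measure" and accept
    using that p t mp by (intro expected_accepted_value_hard_instance_le) auto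
  ultimately show ?thesis
    using assms t prophet_instance_hard_instance[of m "1 / t" p] frequent_hard_instance[of m "1 / t" p]
    by (intro exI[of _ "hard_instance m (1 / t) p"]) force
qed

end
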